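(* Let $K\subset S^3$ be a knot and let $d=\deg_z P_K$ be the maximal $z$-degree of its HOMFLY--PT polynomial. Then $$\mathrm{sp}\Delta_t(K)<d\quad\Longrightarrow\quad \mathrm{td}(K)\ge d+1,$$ where $\mathrm{sp}\Delta_t(K)$ is the span (maximal exponent minus minimal exponent) of the Alexander polynomial $\Delta_K(t)$ and $\mathrm{td}(K)$ is the skein tree depth of $K$.
   Context: The HOMFLY--PT polynomial $P_L(a,z)\in\mathbb Z[a^{\pm1},z^{\pm1}]$ of oriented links is normalised by $P_U(a,z)=1$ for the unknot $U$ and $$a\,P_{L_+}(a,z)-a^{-1}P_{L_-}(a,z)=z\,P_{L_0}(a,z),$$ where $L_+,L_-,L_0$ differ only near one crossing, which is positive, negative, and smoothed according to orientation, respectively. Thus $P_K(1,z)=\nabla_K(z)$ is the Conway polynomial, and up to a unit $\pm t^r$ one has $\Delta_K(t)=\nabla_K(t^{1/2}-t^{-1/2})$. An ordinary oriented binary skein tree for $K$ has a diagram of $K$ at its root and unlink diagrams at its leaves. At each internal vertex a crossing of the current oriented diagram is chosen; one child is obtained by switching that crossing and the other by its oriented smoothing. Reidemeister moves and diagram isotopies may be made without cost between resolutions. The depth of the tree is the maximum number of edges in a root-to-leaf path, counting both switching and smoothing edges. The skein tree depth $\mathrm{td}(K)$ is the minimum of this depth over all such trees and all diagrams of $K$. *)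

theory Defs
  imports
    "HOL-Library.Poly_Mapping"
    "HOL-Library.Product_Plus"
    "HOL-Library.Extended_Nat"
    "HOL-Computational_Algebra.Polynomial"
begin

section \<open>Oriented link diagrams\<close>

text \<open>
  An oriented link diagram is put into general position with respect to the height function of
  the plane, with every crossing turned so that both of its strands point upwards. It is read from
  bottom to top as a list of slices, each containing exactly one minimum (\<open>Cup\<close>), maximum (\<open>Cap\<close>)
  or crossing. Every oriented planar diagram is planar isotopic to one of this form.

  A slice \<open>(i, g)\<close> has \<open>i\<close> vertical strands to the left of the event \<open>g\<close>.
  \<open>Cup b\<close> and \<open>Cap b\<close> have a left leg of orientation \<open>b\<close> and a right leg of the opposite
  orientation. In \<open>Cross Positive\<close> the strand from bottom left to top right is the over-strand,
  in \<open>Cross Negative\<close> it is the under-strand; these are the usual crossing signs.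
\<close>

datatype orient = Up | Down

fun opp :: "orient \<Rightarrow> orient" where
  "opp Up = Down"
| "opp Down = Up"

datatype sign = Positive | Negative

fun flip :: "sign \<Rightarrow> sign" where
  "flip Positive = Negative"
| "flip Negative = Positive"

datatype event = Cup orient | Cap orient | Cross sign

type_synonym slice = "nat \<times> event"
type_synonym diagram = "slice list"

fun dom_event :: "event \<Rightarrow> orient list" where
  "dom_event (Cup b) = []"
| "dom_event (Cap b) = [b, opp b]"
| "dom_event (Cross s) = [Up, Up]"

fun cod_event :: "event \<Rightarrow> orient list" where
  "cod_event (Cup b) = [b, opp b]"
| "cod_event (Cap b) = []"
| "cod_event (Cross s) = [Up, Up]"

abbreviation n_in :: "event \<Rightarrow> nat" where "n_in g \<equiv> length (dom_event g)"
abbreviation n_out :: "event \<Rightarrow> nat" where "n_out g \<equiv> length (cod_event g)"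

text \<open>\<open>run D w\<close> is the word of strand orientations above \<open>D\<close> if the word below it is \<open>w\<close>;
  it is \<open>None\<close> if some slice does not fit the word below it.\<close>

fun run :: "diagram \<Rightarrow> orient list \<Rightarrow> orient list option" where
  "run [] w = Some w"
| "run ((i, g) # D) w =
    (if i \<le> length w \<and> take (n_in g) (drop i w) = dom_event g
     then run D (take i w @ cod_event g @ drop (i + n_in g) w)
     else None)"

definition link_diagram :: "diagram \<Rightarrow> bool" where
  "link_diagram D \<longleftrightarrow> run D [] = Some []"


subsection \<open>Planar isotopy and Reidemeister moves\<close>

text \<open>
  These are the defining relations of the category of oriented tangles (Turaev; see also Kassel,
  Quantum Groups, Theorem XII.2.2): two diagrams are related by the equivalence relation they
  generate iff they represent isotopic oriented links.
  \<^item> Planar isotopy: \<open>interchange\<close> of the heights of two events lying side by side, cancelling a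
    maximum against a neighbouring minimum (\<open>zigzag\<close>), and \<open>pivot\<close>: the two ways of rotating a
    crossing by a half turn agree.
  \<^item> \<open>R1\<close>: a kink on the right or on the left of an upward strand.
  \<^item> \<open>R2\<close>: for parallel strands, and (\<open>R2_anti\<close>) for antiparallel strands; in the latter the two
    crossings occur turned sideways by means of cups and caps.
  \<^item> \<open>R3\<close>.

  The orientations of the strands outside the events displayed below are not mentioned; they are
  determined by requiring both sides to occur in link diagrams.
\<close>

inductive local_move :: "diagram \<Rightarrow> diagram \<Rightarrow> bool" where
  interchange:
    "local_move [(i, g), (i + n_out g + k, h)] [(i + n_in g + k, h), (i, g)]"
| zigzag_left:
    "local_move [(i, Cup b), (i + 1, Cap (opp b))] []"
| zigzag_right:
    "local_move [(i + 1, Cup b), (i, Cap (opp b))] []"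
| pivot:
    "local_move
       [(i + 2, Cup Up), (i + 3, Cup Up), (i + 2, Cross s), (i + 1, Cap Down), (i, Cap Down)]
       [(i, Cup Down), (i + 1, Cup Down), (i + 2, Cross s), (i + 3, Cap Up), (i + 2, Cap Up)]"
| R1_right:
    "local_move [(i + 1, Cup Up), (i, Cross s), (i + 1, Cap Up)] []"
| R1_left:
    "local_move [(i, Cup Down), (i + 1, Cross s), (i, Cap Down)] []"
| R2:
    "local_move [(i, Cross s), (i, Cross (flip s))] []"
| R2_anti_down_up:
    "local_move
       [(i + 2, Cup Up), (i + 1, Cross s), (i, Cap Down),
        (i, Cup Down), (i + 1, Cross (flip s)), (i + 2, Cap Up)] []"
| R2_anti_up_down:
    "local_move
       [(i, Cup Down), (i + 1, Cross s), (i + 2, Cap Up),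
        (i + 2, Cup Up), (i + 1, Cross (flip s)), (i, Cap Down)] []"
| R3:
    "local_move
       [(i, Cross s), (i + 1, Cross s), (i, Cross s)]
       [(i + 1, Cross s), (i, Cross s), (i + 1, Cross s)]"

definition diagram_move :: "diagram \<Rightarrow> diagram \<Rightarrow> bool" where
  "diagram_move D D' \<longleftrightarrow> link_diagram D \<and> link_diagram D' \<and>
     (\<exists>xs ys l r. local_move l r \<and> D = xs @ l @ ys \<and> D' = xs @ r @ ys)"

definition link_equiv :: "diagram \<Rightarrow> diagram \<Rightarrow> bool" (infix "\<simeq>" 50) where
  "D \<simeq> D' \<longleftrightarrow> equivclp diagram_move D D'"


subsection \<open>Components, knots and unlinks\<close>

text \<open>The \<open>j\<close>-th strand between the slices \<open>k - 1\<close> and \<open>k\<close> is the point \<open>(k, j)\<close>.\<close>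

definition points :: "diagram \<Rightarrow> (nat \<times> nat) set" where
  "points D = {(k, j). k \<le> length D \<and> j < length (the (run (take k D) []))}"

inductive joined :: "diagram \<Rightarrow> nat \<times> nat \<Rightarrow> nat \<times> nat \<Rightarrow> bool" for D where
  left: "\<lbrakk>k < length D; D ! k = (i, g); j < i\<rbrakk> \<Longrightarrow> joined D (k, j) (k + 1, j)"
| right: "\<lbrakk>k < length D; D ! k = (i, g)\<rbrakk>
    \<Longrightarrow> joined D (k, i + n_in g + j) (k + 1, i + n_out g + j)"
| cup: "\<lbrakk>k < length D; D ! k = (i, Cup b)\<rbrakk> \<Longrightarrow> joined D (k + 1, i) (k + 1, i + 1)"
| cap: "\<lbrakk>k < length D; D ! k = (i, Cap b)\<rbrakk> \<Longrightarrow> joined D (k, i) (k, i + 1)"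
| cross_up: "\<lbrakk>k < length D; D ! k = (i, Cross s)\<rbrakk> \<Longrightarrow> joined D (k, i) (k + 1, i + 1)"
| cross_down: "\<lbrakk>k < length D; D ! k = (i, Cross s)\<rbrakk> \<Longrightarrow> joined D (k, i + 1) (k + 1, i)"

definition components :: "diagram \<Rightarrow> (nat \<times> nat) set set" where
  "components D = points D //
     {(p, q). p \<in> points D \<and> q \<in> points D \<and>
        equivclp (\<lambda>x y. x \<in> points D \<and> y \<in> points D \<and> joined D x y) p q}"

definition knot_diagram :: "diagram \<Rightarrow> bool" where
  "knot_diagram D \<longleftrightarrow> link_diagram D \<and> card (components D) = 1"

definition circles :: "nat \<Rightarrow> diagram" where
  "circles n = concat (replicate n [(0, Cup Up), (0, Cap Up)])"

definition unlink_diagram :: "diagram \<Rightarrow> bool" where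
  "unlink_diagram D \<longleftrightarrow> (\<exists>n\<ge>1. D \<simeq> circles n)"


subsection \<open>Switching and smoothing a crossing\<close>

text \<open>Since both strands of a crossing point upwards, its oriented smoothing consists of two
  vertical strands: the slice is simply deleted.\<close>

definition crossing_at :: "diagram \<Rightarrow> nat \<Rightarrow> sign \<Rightarrow> bool" where
  "crossing_at D c s \<longleftrightarrow> c < length D \<and> snd (D ! c) = Cross s"

fun flip_event :: "event \<Rightarrow> event" where
  "flip_event (Cross s) = Cross (flip s)"
| "flip_event g = g"

definition switch :: "diagram \<Rightarrow> nat \<Rightarrow> diagram" where
  "switch D c = D[c := map_prod id flip_event (D ! c)]"

definition smooth :: "diagram \<Rightarrow> nat \<Rightarrow> diagram" where
  "smooth D c = take c D @ drop (Suc c) D"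


section \<open>Skein trees\<close>

text \<open>\<open>Node D c S T\<close> resolves the crossing at slice \<open>c\<close> of \<open>D\<close>; the subtree \<open>S\<close> belongs to
  the switched diagram and \<open>T\<close> to the smoothed one.\<close>

datatype skein_tree = Leaf (root: diagram) | Node (root: diagram) nat skein_tree skein_tree

fun tree_depth :: "skein_tree \<Rightarrow> nat" where
  "tree_depth (Leaf D) = 0"
| "tree_depth (Node D c S T) = Suc (max (tree_depth S) (tree_depth T))"

fun valid_tree :: "skein_tree \<Rightarrow> bool" where
  "valid_tree (Leaf D) \<longleftrightarrow> unlink_diagram D"
| "valid_tree (Node D c S T) \<longleftrightarrow>
     link_diagram D \<and> (\<exists>s. crossing_at D c s) \<and>
     switch D c \<simeq> root S \<and> smooth D c \<simeq> root T \<and>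
     valid_tree S \<and> valid_tree T"

definition skein_tree_depth :: "diagram \<Rightarrow> enat" where
  "skein_tree_depth K = (INF T \<in> {T. valid_tree T \<and> K \<simeq> root T}. enat (tree_depth T))"


section \<open>Polynomial invariants\<close>

text \<open>Laurent polynomials are group rings of free abelian groups: a finitely supported map
  sending exponents to coefficients, with convolution as multiplication. For two variables the
  exponent \<open>(i, j)\<close> stands for the monomial \<open>a\<^sup>i z\<^sup>j\<close>.\<close>

type_synonym laurent = "int \<Rightarrow>\<^sub>0 int"
type_synonym laurent2 = "(int \<times> int) \<Rightarrow>\<^sub>0 int"

definition monom1 :: "int \<Rightarrow> laurent" where
  "monom1 i = Poly_Mapping.single i 1"

definition monom2 :: "int \<Rightarrow> int \<Rightarrow> laurent2" where
  "monom2 i j = Poly_Mapping.single (i, j) 1"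

definition laurent_span :: "laurent \<Rightarrow> int" where
  "laurent_span p = Max (Poly_Mapping.keys p) - Min (Poly_Mapping.keys p)"

definition deg_z :: "laurent2 \<Rightarrow> int" where
  "deg_z p = Max (snd ` Poly_Mapping.keys p)"

text \<open>Substitution induced by a homomorphism \<open>f\<close> of exponent groups:
  \<open>f = snd\<close> gives \<open>p(1, z)\<close> and \<open>f = (*) 2\<close> gives \<open>p(s\<^sup>2)\<close>.\<close>

definition subst_exponents :: "('a \<Rightarrow> 'b) \<Rightarrow> ('a \<Rightarrow>\<^sub>0 int) \<Rightarrow> ('b \<Rightarrow>\<^sub>0 int)" where
  "subst_exponents f p =
     (\<Sum>k\<in>Poly_Mapping.keys p. Poly_Mapping.single (f k) (Poly_Mapping.lookup p k))"

text \<open>The defining properties of the HOMFLY--PT polynomial, which determine it on all nonempty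
  link diagrams.\<close>

definition is_homfly :: "(diagram \<Rightarrow> laurent2) \<Rightarrow> bool" where
  "is_homfly P \<longleftrightarrow>
     (\<forall>D D'. link_diagram D \<and> D \<simeq> D' \<longrightarrow> P D = P D') \<and>
     P (circles 1) = 1 \<and>
     (\<forall>D c. link_diagram D \<and> crossing_at D c Positive \<longrightarrow>
        monom2 1 0 * P D - monom2 (-1) 0 * P (switch D c) = monom2 0 1 * P (smooth D c))"

definition is_conway :: "(diagram \<Rightarrow> laurent2) \<Rightarrow> diagram \<Rightarrow> int poly \<Rightarrow> bool" where
  "is_conway P D C \<longleftrightarrow> subst_exponents snd (P D) = poly (map_poly of_int C) (monom1 1)"

text \<open>With \<open>s = t\<^bsup>1/2\<^esup>\<close>, the Alexander polynomial satisfies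
  \<open>\<Delta>(s\<^sup>2) = \<plusminus> s\<^bsup>2r\<^esup> \<nabla>(s - s\<^bsup>-1\<^esup>)\<close>; it is only defined up to units \<open>\<plusminus> t\<^sup>r\<close>.\<close>

definition is_alexander :: "(diagram \<Rightarrow> laurent2) \<Rightarrow> diagram \<Rightarrow> laurent \<Rightarrow> bool" where
  "is_alexander P D \<Delta> \<longleftrightarrow>
     (\<exists>C \<epsilon> r. is_conway P D C \<and> \<epsilon> \<in> {1, -1} \<and>
        subst_exponents ((*) 2) \<Delta> =
          \<epsilon> * monom1 (2 * r) * poly (map_poly of_int C) (monom1 1 - monom1 (-1)))"

end

theory Submission
  imports Defs
begin

text \<open>
  Every step of a skein tree writes \<open>P\<close> of a diagram as \<open>a\<^bsup>\<plusminus>2\<^esup>\<close> times \<open>P\<close> of the switched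
  diagram plus or minus \<open>a\<^bsup>\<plusminus>1\<^esup> z\<close> times \<open>P\<close> of the smoothed one, and an unlink of \<open>c\<close> components
  has the value \<open>((a - a\<^sup>-\<^sup>1) / z)\<^bsup>c - 1\<^esup>\<close>. So a leaf reached by \<open>m\<close> smoothings contributes at most
  the \<open>z\<close>-degree \<open>m - (c - 1)\<close>. In a tree of depth \<open>n\<close> the exponent \<open>n\<close> can come from one leaf
  only, namely from the path that consists of \<open>n\<close> smoothings and ends at the unknot, and that leaf
  contributes a single monomial \<open>\<plusminus>a\<^sup>i z\<^sup>n\<close>. This is the content of \<open>z_leading_bound_tree\<close>.

  If the depth \<open>n\<close> were at most \<open>d = deg_z P\<close>, then \<open>n = d\<close>, as \<open>n\<close> bounds the \<open>z\<close>-degree, and the leading part of \<open>P\<close> in \<open>z\<close>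
  would be one monomial \<open>\<plusminus>a\<^sup>i z\<^sup>d\<close>. It cannot be cancelled by setting \<open>a = 1\<close>, so the Conway
  polynomial has degree exactly \<open>d\<close> (\<open>degree_conway\<close>). Substituting \<open>t\<^bsup>1/2\<^esup> - t\<^bsup>-1/2\<^esup>\<close> turns degree
  into span (\<open>laurent_span_alexander\<close>), whence the Alexander polynomial has span \<open>d\<close>. A smaller span
  therefore forces the depth above \<open>d\<close>.

  The degree of \<open>P\<close> is meaningful only if \<open>P \<noteq> 0\<close>. This follows by evaluating at a point
  with \<open>a - a\<^sup>-\<^sup>1 = z\<close>, where \<open>P\<close> takes the value 1 on every diagram that has a skein tree
  (\<open>homfly_tree_eval\<close>).
\<close>

section \<open>Coefficients of Laurent polynomials\<close>

lemma lookup_single_times: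
  fixes p :: "'a::ab_group_add \<Rightarrow>\<^sub>0 int"
  shows "Poly_Mapping.lookup (Poly_Mapping.single m c * p) k = c * Poly_Mapping.lookup p (k - m)"
proof -
  have q: "(\<Sum>q. Poly_Mapping.lookup p q when k = l + q) = Poly_Mapping.lookup p (k - l)" for l
  proof -
    have "(k = l + q) = (k - l = q)" for q by (auto simp: algebra_simps)
    then show ?thesis by simp
  qed
  show ?thesis
    by (simp add: lookup_mult q lookup_single when_mult)
qed

lemma lookup_monom1_times:
  "Poly_Mapping.lookup (monom1 m * p) k = Poly_Mapping.lookup p (k - m)"
  by (simp add: monom1_def lookup_single_times)

lemma lookup_monom2_times:
  "Poly_Mapping.lookup (monom2 x y * p) (i, j) = Poly_Mapping.lookup p (i - x, j - y)"
  by (simp add: monom2_def lookup_single_times)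

section \<open>Crossing changes and the invariance of the HOMFLY--PT polynomial\<close>

lemma run_append: "run (xs @ ys) w = Option.bind (run xs w) (run ys)"
  by (induction xs w rule: run.induct) auto

lemma run_circles: "run (circles n) [] = Some []"
  by (induction n) (auto simp: circles_def)

lemma circles_Suc: "circles (Suc n) = [(0, Cup Up), (0, Cap Up)] @ circles n"
  by (simp add: circles_def)

lemma link_diagram_append_circles:
  "run D [] = Some [] \<Longrightarrow> link_diagram (D @ circles n)"
  by (simp add: link_diagram_def run_append run_circles)

lemma switch_switch: "switch (switch D c) c = D"
proof (cases "c < length D")
  case True
  have "flip_event (flip_event g) = g" for g
    by (cases g) (auto elim: flip.elims, metis flip.simps sign.exhaust)
  then show ?thesis
    using True by (simp add: switch_def prod.map_comp o_def map_prod_def split_beta)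
qed (simp add: switch_def list_update_beyond)

lemma smooth_switch: "smooth (switch D c) c = smooth D c"
  by (simp add: smooth_def switch_def)

lemma run_switch: "run (switch D c) w = run D w"
proof (induction D w arbitrary: c rule: run.induct)
  case (2 i g D w)
  have "dom_event (flip_event g) = dom_event g \<and> cod_event (flip_event g) = cod_event g"
    by (cases g) auto
  with 2 show ?case
    by (cases c) (auto simp: switch_def)
qed (simp add: switch_def)

text \<open>Equivalent diagrams that differ are joined by at least one move, and a move can only start at
  a link diagram; hence the invariance of \<open>P\<close> on link diagrams extends to all equivalent pairs.\<close>

lemma homfly_invariant:
  assumes "is_homfly P" "D \<simeq> D'"
  shows "P D = P D'"
proof -
  have "D = D' \<or> link_diagram D"
    using assms(2) unfolding link_equiv_def
    by (induction rule: equivclp_induct) (auto simp: diagram_move_def)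
  then show ?thesis using assms unfolding is_homfly_def by blast
qed

lemma homfly_diagram_move:
  assumes "is_homfly P" "local_move l r"
    and "link_diagram (xs @ l @ ys)" "link_diagram (xs @ r @ ys)"
  shows "P (xs @ l @ ys) = P (xs @ r @ ys)"
proof -
  have "diagram_move (xs @ l @ ys) (xs @ r @ ys)"
    using assms by (auto simp: diagram_move_def)
  then show ?thesis
    using assms(1) by (intro homfly_invariant) (auto simp: link_equiv_def)
qed

lemma homfly_positive_skein:
  assumes "is_homfly P" "link_diagram D" "crossing_at D c Positive"
  shows "monom2 1 0 * P D - monom2 (-1) 0 * P (switch D c) = monom2 0 1 * P (smooth D c)"
  using assms by (auto simp: is_homfly_def)

text \<open>Switching a negative crossing gives a positive one at which the defining skein relation
  applies; switching back and smoothing recover the diagrams in the roles displayed here.\<close>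

lemma homfly_negative_skein:
  assumes "is_homfly P" "link_diagram D" "crossing_at D c Negative"
  shows "monom2 1 0 * P (switch D c) - monom2 (-1) 0 * P D = monom2 0 1 * P (smooth D c)"
proof -
  have "link_diagram (switch D c)"
    using assms(2) by (simp add: link_diagram_def run_switch)
  moreover have "crossing_at (switch D c) c Positive"
    using assms(3) by (simp add: crossing_at_def switch_def)
  ultimately show ?thesis
    using homfly_positive_skein[OF assms(1), of "switch D c" c]
    by (simp add: switch_switch smooth_switch)
qed

section \<open>Unlinks\<close>

text \<open>The left lobe runs counterclockwise and the right one clockwise. Smoothing the crossing therefore separates the lobes into two circles lying side by
  side, not into nested ones.\<close>

definition figure_eight :: "sign \<Rightarrow> diagram" where
  "figure_eight s = [(0, Cup Down), (2, Cup Up), (1, Cross s), (0, Cap Down), (0, Cap Up)]"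

text \<open>Either lobe of the figure-eight curve can be removed as a kink. The remaining
  circles have opposite orientations, so the two facts together also show that
  \<open>P\<close> does not distinguish the two orientations of a round circle.\<close>

lemma homfly_figure_eight:
  assumes "is_homfly P"
  shows "P (figure_eight s @ circles n) = P (circles (Suc n))"
    and "P (figure_eight s @ circles n) = P ([(0, Cup Down), (0, Cap Down)] @ circles n)"
proof -
  note moves = homfly_diagram_move[OF assms] and lk = link_diagram_append_circles
  let ?r1 = "[(0, Cup Up), (0, Cup Down), (1, Cross s), (0, Cap Down), (0, Cap Up)]"
  let ?r2 = "[(0, Cup Down), (2, Cup Up), (1, Cross s), (2, Cap Up), (0, Cap Down)]"
  have run: "run (figure_eight s) [] = Some []" "run ?r1 [] = Some []" "run ?r2 [] = Some []"
    "run [(0, Cup Down), (0, Cap Down)] [] = Some []"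
    by (auto simp: figure_eight_def)
  \<comment> \<open>Exchanging the heights of the two minima makes the left lobe a kink on the left of a strand.\<close>
  have "P (figure_eight s @ circles n) = P (?r1 @ circles n)"
    using moves[OF local_move.interchange[of 0 "Cup Down" 0 "Cup Up"], of "[]"
        "[(1, Cross s), (0, Cap Down), (0, Cap Up)] @ circles n"]
      lk[OF run(1)] lk[OF run(2)]
    by (simp add: figure_eight_def numeral_2_eq_2)
  also have "\<dots> = P (circles (Suc n))"
    using moves[OF local_move.R1_left[of 0 s], of "[(0, Cup Up)]" "[(0, Cap Up)] @ circles n"]
      lk[OF run(2)] lk[of "[]" "Suc n"]
    by (simp add: circles_Suc)
  finally show "P (figure_eight s @ circles n) = P (circles (Suc n))" .
  \<comment> \<open>Exchanging the heights of the two maxima makes the right lobe a kink on the right.\<close>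
  have "P (figure_eight s @ circles n) = P (?r2 @ circles n)"
    using moves[OF local_move.interchange[of 0 "Cap Down" 0 "Cap Up"],
        of "[(0, Cup Down), (2, Cup Up), (1, Cross s)]" "circles n"]
      lk[OF run(1)] lk[OF run(3)]
    by (simp add: figure_eight_def numeral_2_eq_2)
  also have "\<dots> = P ([(0, Cup Down), (0, Cap Down)] @ circles n)"
    using moves[OF local_move.R1_right[of 1 s], of "[(0, Cup Down)]" "[(0, Cap Down)] @ circles n"]
      lk[OF run(3)] lk[OF run(4)]
    by (simp add: numeral_2_eq_2)
  finally show "P (figure_eight s @ circles n) = P ([(0, Cup Down), (0, Cap Down)] @ circles n)" .
qed

text \<open>This is the formula \<open>P (U\<^bsub>c+1\<^esub>) = (a - a\<^sup>-\<^sup>1) / z \<cdot> P (U\<^bsub>c\<^esub>)\<close> for unlinks. It is the skein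
  relation at the crossing of a figure-eight curve: with either sign of the crossing the curve is an
  unknot, and its smoothing has one more component.\<close>

lemma homfly_circles_Suc:
  assumes "is_homfly P"
  shows "monom2 1 0 * P (circles (Suc n)) - monom2 (-1) 0 * P (circles (Suc n)) =
    monom2 0 1 * P (circles (Suc (Suc n)))"
proof -
  let ?D = "figure_eight Positive @ circles n"
  let ?two = "[(0, Cup Down), (0, Cap Down)] @ circles (Suc n)"
  have "switch ?D 2 = figure_eight Negative @ circles n"
    by (simp add: switch_def figure_eight_def numeral_2_eq_2)
  \<comment> \<open>The two circles of the smoothing overlap in height; lowering the left maximum stacks them.\<close>
  moreover have "P (smooth ?D 2) = P ?two"
    using homfly_diagram_move[OF assms local_move.interchange[of 0 "Cap Down" 0 "Cup Up"],
        of "[(0, Cup Down)]" "[(0, Cap Up)] @ circles n"]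
    by (simp add: link_diagram_def run_circles run_append smooth_def figure_eight_def
        numeral_2_eq_2 circles_Suc)
  moreover have "link_diagram ?D" "crossing_at ?D 2 Positive"
    by (simp_all add: link_diagram_def run_circles run_append figure_eight_def crossing_at_def
        numeral_2_eq_2)
  ultimately show ?thesis
    using homfly_positive_skein[OF assms, of ?D 2] homfly_figure_eight[OF assms] by metis
qed

section \<open>The leading coefficient in \<open>z\<close>\<close>

text \<open>The coefficient of \<open>z\<^sup>n\<close> is \<open>e a\<^bsup>i\<^sub>0\<^esup>\<close> and higher powers of \<open>z\<close> do not occur. The case \<open>e = 0\<close>
  is included, so that the property also covers polynomials of smaller degree and is monotone in
  \<open>n\<close>.\<close>

definition z_leading_bound :: "nat \<Rightarrow> laurent2 \<Rightarrow> bool" where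
  "z_leading_bound n p \<longleftrightarrow> (\<exists>e\<in>{-1, 0, 1}. \<exists>i\<^sub>0. \<forall>i j. int n \<le> j \<longrightarrow>
     Poly_Mapping.lookup p (i, j) = (e when (i, j) = (i\<^sub>0, int n)))"

lemma z_leading_bound_mono:
  assumes "z_leading_bound m p" "m \<le> n"
  shows "z_leading_bound n p"
proof (cases "m = n")
  case False
  with assms have "\<forall>i j. int n \<le> j \<longrightarrow> Poly_Mapping.lookup p (i, j) = 0"
    by (fastforce simp: z_leading_bound_def)
  then show ?thesis by (auto simp: z_leading_bound_def)
qed (use assms in simp)

lemma homfly_skein_coefficients:
  assumes "monom2 1 0 * p - monom2 (-1) 0 * q = monom2 0 1 * r"
  shows "Poly_Mapping.lookup p (i - 1, j) - Poly_Mapping.lookup q (i + 1, j) =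
    Poly_Mapping.lookup r (i, j - 1)"
  using arg_cong[OF assms, of "\<lambda>p. Poly_Mapping.lookup p (i, j)"]
  by (simp add: lookup_minus lookup_monom2_times)

text \<open>Only the smoothed term is multiplied by \<open>z\<close>. The switched term, which has \<open>z\<close>-degree at most
  \<open>n\<close>, does not reach the exponent \<open>n + 1\<close>; so the leading monomial of the smoothed term is passed on,
  up to its sign and a shift in \<open>a\<close>.\<close>

lemma z_leading_bound_skein:
  assumes skein: "monom2 1 0 * p - monom2 (-1) 0 * q = monom2 0 1 * r"
    and r: "z_leading_bound n r"
  shows "z_leading_bound n q \<Longrightarrow> z_leading_bound (Suc n) p"
    and "z_leading_bound n p \<Longrightarrow> z_leading_bound (Suc n) q"
proof -
  obtain e i0 where e: "e \<in> {-1, 0, 1}"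
    and r: "\<And>i j. int n \<le> j \<Longrightarrow> Poly_Mapping.lookup r (i, j) = (e when (i, j) = (i0, int n))"
    using r unfolding z_leading_bound_def by blast
  note coeffs = homfly_skein_coefficients[OF skein]
  show "z_leading_bound (Suc n) p" if "z_leading_bound n q"
  proof -
    have "Poly_Mapping.lookup p (i, j) = (e when (i, j) = (i0 - 1, int (Suc n)))"
      if "int (Suc n) \<le> j" for i j
    proof -
      have "Poly_Mapping.lookup q (2 + i, j) = 0"
        using \<open>z_leading_bound n q\<close> that by (auto simp: z_leading_bound_def)
      then show ?thesis
        using coeffs[of "i + 1" j] r[of "j - 1" "i + 1"] that by (auto simp: when_def)
    qed
    with e show ?thesis unfolding z_leading_bound_def by blast
  qed
  show "z_leading_bound (Suc n) q" if "z_leading_bound n p"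
  proof -
    have "Poly_Mapping.lookup q (i, j) = (- e when (i, j) = (i0 + 1, int (Suc n)))"
      if "int (Suc n) \<le> j" for i j
    proof -
      have "Poly_Mapping.lookup p (i - 2, j) = 0"
        using \<open>z_leading_bound n p\<close> that by (auto simp: z_leading_bound_def)
      then show ?thesis
        using coeffs[of "i - 1" j] r[of "j - 1" "i - 1"] that by (auto simp: when_def)
    qed
    moreover have "- e \<in> {-1, 0, 1}" using e by auto
    ultimately show ?thesis unfolding z_leading_bound_def by blast
  qed
qed

text \<open>Each component beyond the first divides by \<open>z\<close>, so the \<open>z\<close>-degree for \<open>n + 1\<close> circles is
  at most \<open>-n\<close>.\<close>

lemma homfly_circles_z_degree:
  assumes "is_homfly P" "- int n < j"
  shows "Poly_Mapping.lookup (P (circles (Suc n))) (i, j) = 0"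
  using assms(2)
proof (induction n arbitrary: i j)
  case 0
  moreover have "P (circles (Suc 0)) = 1" using assms(1) by (simp add: is_homfly_def)
  ultimately show ?case by (simp add: lookup_one zero_prod_def)
next
  case (Suc n)
  then show ?case
    using homfly_skein_coefficients[OF homfly_circles_Suc[OF assms(1), of n], of i "j + 1"] by simp
qed

lemma z_leading_bound_circles:
  assumes "is_homfly P" "1 \<le> n"
  shows "z_leading_bound 0 (P (circles n))"
proof (cases "n = 1")
  case True
  then have "P (circles n) = 1" using assms(1) by (simp add: is_homfly_def)
  then show ?thesis
    by (auto simp: z_leading_bound_def lookup_one zero_prod_def when_def
        intro!: bexI[of _ 1] exI[of _ 0])
next
  case False
  with assms(2) obtain m where "n = Suc (Suc m)"
    by (cases n; cases "n - 1") auto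
  then show ?thesis
    using homfly_circles_z_degree[OF assms(1), of "Suc m"] by (auto simp: z_leading_bound_def)
qed

section \<open>Skein trees\<close>

lemma valid_tree_induct [consumes 1, case_names leaf node]:
  assumes "valid_tree T"
    and "\<And>D n. 1 \<le> n \<Longrightarrow> D \<simeq> circles n \<Longrightarrow> Q (Leaf D)"
    and "\<And>D c S T s. link_diagram D \<Longrightarrow> crossing_at D c s \<Longrightarrow> switch D c \<simeq> root S \<Longrightarrow>
      smooth D c \<simeq> root T \<Longrightarrow> Q S \<Longrightarrow> Q T \<Longrightarrow> Q (Node D c S T)"
  shows "Q T"
  using assms(1) by (induction T) (auto simp: unlink_diagram_def intro: assms(2,3))

text \<open>At the leaves, one circle has the value 1 and more circles have negative \<open>z\<close>-degree. Each
  vertex then raises the bound by one, and the depth counts these vertices.\<close>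

lemma z_leading_bound_tree:
  assumes "is_homfly P" "valid_tree T"
  shows "z_leading_bound (tree_depth T) (P (root T))"
  using assms(2)
proof (induction rule: valid_tree_induct)
  case (leaf D n)
  then show ?case
    using z_leading_bound_circles[OF assms(1)] homfly_invariant[OF assms(1)] by simp
next
  case (node D c S T s)
  let ?n = "max (tree_depth S) (tree_depth T)"
  have "z_leading_bound ?n (P (switch D c))" "z_leading_bound ?n (P (smooth D c))"
    using node.IH homfly_invariant[OF assms(1) node.hyps(3)] homfly_invariant[OF assms(1) node.hyps(4)]
    by (auto intro: z_leading_bound_mono)
  then show ?case
    using homfly_positive_skein[OF assms(1) node.hyps(1), of c]
      homfly_negative_skein[OF assms(1) node.hyps(1), of c] node.hyps(2)
      z_leading_bound_skein
    by (cases s) (fastforce)+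
qed

section \<open>Nonvanishing of the HOMFLY--PT polynomial\<close>

definition eval_rat :: "rat \<Rightarrow> rat \<Rightarrow> laurent2 \<Rightarrow> rat" where
  "eval_rat x y p = (\<Sum>(i, j)\<in>Poly_Mapping.keys p.
     of_int (Poly_Mapping.lookup p (i, j)) * (x powi i * y powi j))"

text \<open>Sums over a common finite set of exponents are needed to compare polynomials with different
  supports.\<close>

lemma eval_rat_superset:
  assumes "finite A" "Poly_Mapping.keys p \<subseteq> A"
  shows "eval_rat x y p =
    (\<Sum>(i, j)\<in>A. of_int (Poly_Mapping.lookup p (i, j)) * (x powi i * y powi j))"
  unfolding eval_rat_def
  by (rule sum.mono_neutral_left) (use assms in \<open>auto simp: in_keys_iff\<close>)

lemma eval_rat_diff: "eval_rat x y (p - q) = eval_rat x y p - eval_rat x y q"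
proof -
  let ?A = "Poly_Mapping.keys p \<union> Poly_Mapping.keys q \<union> Poly_Mapping.keys (p - q)"
  have "finite ?A" by simp
  note sup = eval_rat_superset[OF this]
  show ?thesis
    by (subst (1 2 3) sup)
      (auto simp: lookup_minus sum_subtractf[symmetric] left_diff_distrib intro!: sum.cong)
qed

lemma eval_rat_monom2_times:
  assumes "x \<noteq> 0" "y \<noteq> 0"
  shows "eval_rat x y (monom2 k l * p) = x powi k * y powi l * eval_rat x y p"
proof -
  let ?f = "\<lambda>(i, j). (i + k, j + l)"
  have keys: "Poly_Mapping.keys (monom2 k l * p) = ?f ` Poly_Mapping.keys p"
  proof (intro equalityI subsetI)
    fix m assume "m \<in> Poly_Mapping.keys (monom2 k l * p)"
    then have "(fst m - k, snd m - l) \<in> Poly_Mapping.keys p"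
      by (cases m) (simp add: in_keys_iff lookup_monom2_times)
    then show "m \<in> ?f ` Poly_Mapping.keys p"
      by (rule rev_image_eqI) simp
  qed (auto simp: in_keys_iff lookup_monom2_times)
  have "inj_on ?f (Poly_Mapping.keys p)" by (auto simp: inj_on_def)
  then show ?thesis
    using assms unfolding eval_rat_def keys
    by (auto simp: sum.reindex lookup_monom2_times power_int_add sum_distrib_left intro!: sum.cong)
qed

text \<open>The values \<open>a = 2\<close> and \<open>z = 3/2\<close> are chosen such that \<open>a - a\<^sup>-\<^sup>1 = z\<close>. At such a point the
  constant 1 satisfies the skein relation, and any two of the three values being 1 force the third to
  be 1.\<close>

lemma homfly_skein_eval:
  assumes "monom2 1 0 * p - monom2 (-1) 0 * q = monom2 0 1 * r"
  shows "2 * eval_rat 2 (3/2) p - eval_rat 2 (3/2) q / 2 = 3/2 * eval_rat 2 (3/2) r"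
  using arg_cong[OF assms, of "eval_rat 2 (3/2)"]
  by (simp add: eval_rat_diff eval_rat_monom2_times)

lemma homfly_circles_eval:
  assumes "is_homfly P"
  shows "eval_rat 2 (3/2) (P (circles (Suc n))) = 1"
proof (induction n)
  case 0
  then show ?case using assms by (simp add: is_homfly_def eval_rat_def zero_prod_def lookup_one)
next
  case (Suc n)
  then show ?case using homfly_skein_eval[OF homfly_circles_Suc[OF assms, of n]] by simp
qed

lemma homfly_tree_eval:
  assumes "is_homfly P" "valid_tree T"
  shows "eval_rat 2 (3/2) (P (root T)) = 1"
  using assms(2)
proof (induction rule: valid_tree_induct)
  case (leaf D n)
  then show ?case
    using homfly_circles_eval[OF assms(1), of "n - 1"] homfly_invariant[OF assms(1)] by simp
next
  case (node D c S T s)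
  note node.IH[folded homfly_invariant[OF assms(1) node.hyps(3)] homfly_invariant[OF assms(1) node.hyps(4)]]
  then show ?case
    using homfly_skein_eval[OF homfly_positive_skein[OF assms(1) node.hyps(1), of c]]
      homfly_skein_eval[OF homfly_negative_skein[OF assms(1) node.hyps(1), of c]] node.hyps(2)
    by (cases s) simp_all
qed

section \<open>Degree of the Conway polynomial and span of the Alexander polynomial\<close>

lemma lookup_subst_exponents:
  "Poly_Mapping.lookup (subst_exponents f p) k =
    (\<Sum>m\<in>{m \<in> Poly_Mapping.keys p. f m = k}. Poly_Mapping.lookup p m)"
  by (simp add: subst_exponents_def lookup_sum lookup_single when_def sum.inter_filter)

lemma keys_subst_exponents_inj:
  assumes "inj f"
  shows "Poly_Mapping.keys (subst_exponents f p) = f ` Poly_Mapping.keys p"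
proof -
  have "{m \<in> Poly_Mapping.keys p. f m = f k} = (if k \<in> Poly_Mapping.keys p then {k} else {})" for k
    using assms by (auto simp: inj_def)
  then have at_image: "Poly_Mapping.lookup (subst_exponents f p) (f k) = Poly_Mapping.lookup p k" for k
    by (simp add: lookup_subst_exponents in_keys_iff)
  have off_image: "Poly_Mapping.lookup (subst_exponents f p) k = 0" if "k \<notin> range f" for k
    unfolding lookup_subst_exponents by (rule sum.neutral) (use that in blast)
  show ?thesis
  proof (intro equalityI subsetI)
    fix k assume k: "k \<in> Poly_Mapping.keys (subst_exponents f p)"
    then obtain m where "k = f m" using off_image by (metis in_keys_iff rangeE)
    with k at_image show "k \<in> f ` Poly_Mapping.keys p" by (auto simp: in_keys_iff)
  qed (auto simp: in_keys_iff at_image)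
qed

lemma poly_map_of_int_altdef:
  fixes x :: "'a::{comm_ring_1,ring_char_0}"
  shows "poly (map_poly of_int C) x = (\<Sum>i\<le>degree C. of_int (coeff C i) * x ^ i)"
  by (simp add: poly_altdef degree_map_poly coeff_map_poly)

lemma lookup_of_int_times:
  fixes p :: laurent
  shows "Poly_Mapping.lookup (of_int c * p) k = c * Poly_Mapping.lookup p k"
  by (simp add: lookup_single_times flip: single_of_int)

lemma lookup_poly_monom1:
  "Poly_Mapping.lookup (poly (map_poly of_int C) (monom1 1)) (int k) = coeff C k"
proof -
  have pow: "monom1 1 ^ i = monom1 (int i)" for i
    by (induction i) (auto simp: monom1_def mult_single)
  have "Poly_Mapping.lookup (poly (map_poly of_int C) (monom1 1)) (int k) =
      (\<Sum>i\<le>degree C. if i = k then coeff C i else 0)"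
    unfolding poly_map_of_int_altdef lookup_sum lookup_of_int_times pow
    by (rule sum.cong) (simp_all add: monom1_def lookup_single when_def)
  also have "\<dots> = coeff C k"
    by (simp add: coeff_eq_0)
  finally show ?thesis .
qed

text \<open>These are the two extreme terms of the binomial expansion of \<open>(s - s\<^sup>-\<^sup>1)\<^sup>k\<close>.\<close>

lemma lookup_diff_monom1_power:
  shows "int k < \<bar>m\<bar> \<Longrightarrow> Poly_Mapping.lookup ((monom1 1 - monom1 (-1)) ^ k) m = 0"
    and "Poly_Mapping.lookup ((monom1 1 - monom1 (-1)) ^ k) (int k) = 1"
    and "Poly_Mapping.lookup ((monom1 1 - monom1 (-1)) ^ k) (- int k) = (-1) ^ k"
proof -
  have step: "Poly_Mapping.lookup ((monom1 1 - monom1 (-1)) ^ Suc k) m =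
      Poly_Mapping.lookup ((monom1 1 - monom1 (-1)) ^ k) (m - 1) -
      Poly_Mapping.lookup ((monom1 1 - monom1 (-1)) ^ k) (m + 1)" for k m
    by (simp add: left_diff_distrib lookup_minus lookup_monom1_times)
  show outside: "Poly_Mapping.lookup ((monom1 1 - monom1 (-1)) ^ k) m = 0" if "int k < \<bar>m\<bar>" for k m
    using that
  proof (induction k arbitrary: m)
    case 0
    then show ?case by (simp add: lookup_one)
  next
    case (Suc k)
    then show ?case by (simp add: step Suc.IH del: power_Suc)
  qed
  show "Poly_Mapping.lookup ((monom1 1 - monom1 (-1)) ^ k) (int k) = 1"
    by (induction k) (simp, simp add: step outside add.commute del: power_Suc)
  show "Poly_Mapping.lookup ((monom1 1 - monom1 (-1)) ^ k) (- int k) = (-1) ^ k"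
  proof (induction k)
    case (Suc k)
    have "- int (Suc k) + 1 = - int k" by simp
    then show ?case
      using Suc.IH by (simp only: step) (simp add: outside)
  qed simp
qed

text \<open>In \<open>C (s - s\<^sup>-\<^sup>1)\<close> the exponents \<open>\<plusminus>degree C\<close> of \<open>s\<close> come from the top power alone, so their
  coefficients are the leading coefficient of \<open>C\<close> up to sign and do not vanish. The span in \<open>s\<close> is
  thus \<open>2 degree C\<close>, and the span in \<open>t = s\<^sup>2\<close> is \<open>degree C\<close>.\<close>

lemma laurent_span_alexander:
  assumes C: "C \<noteq> 0"
    and \<Delta>: "\<epsilon> \<in> {1, -1}"
      "subst_exponents ((*) 2) \<Delta> =
        \<epsilon> * monom1 (2 * r) * poly (map_poly of_int C) (monom1 1 - monom1 (-1))"
  shows "laurent_span \<Delta> = int (degree C)"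
proof -
  let ?n = "degree C" and ?y = "monom1 1 - monom1 (-1)"
  define q where "q = poly (map_poly of_int C) ?y"
  have q: "Poly_Mapping.lookup q m =
      (\<Sum>i\<le>?n. coeff C i * Poly_Mapping.lookup (?y ^ i) m)" for m
    by (simp add: q_def poly_map_of_int_altdef lookup_sum lookup_of_int_times)
  have outside: "Poly_Mapping.lookup q m = 0" if "int ?n < \<bar>m\<bar>" for m
    unfolding q by (rule sum.neutral) (use that in \<open>auto simp: lookup_diff_monom1_power(1)\<close>)
  have extreme: "Poly_Mapping.lookup q m = lead_coeff C * Poly_Mapping.lookup (?y ^ ?n) m"
    if "\<bar>m\<bar> = int ?n" for m
  proof -
    have "(\<Sum>i\<in>{..<?n}. coeff C i * Poly_Mapping.lookup (?y ^ i) m) = 0"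
      by (rule sum.neutral) (use that in \<open>auto simp: lookup_diff_monom1_power(1)\<close>)
    then show ?thesis
      unfolding q lessThan_Suc_atMost[symmetric] by simp
  qed
  have \<Delta>': "subst_exponents ((*) 2) \<Delta> = \<epsilon> * (monom1 (2 * r) * q)"
    using \<Delta>(2) by (simp add: q_def mult.assoc)
  have "Poly_Mapping.keys (subst_exponents ((*) 2) \<Delta>) =
      Poly_Mapping.keys (monom1 (2 * r) * q)"
    using \<Delta>(1) unfolding \<Delta>' by (auto simp: in_keys_iff)
  moreover have "inj ((*) (2 :: int))" by (auto simp: inj_def)
  ultimately have "(*) 2 ` Poly_Mapping.keys \<Delta> = {m. Poly_Mapping.lookup q (m - 2 * r) \<noteq> 0}"
    by (auto simp: keys_subst_exponents_inj in_keys_iff lookup_monom1_times)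
  then have keys: "m \<in> (*) 2 ` Poly_Mapping.keys \<Delta> \<longleftrightarrow> Poly_Mapping.lookup q (m - 2 * r) \<noteq> 0" for m
    by blast
  \<comment> \<open>The exponents of \<open>s\<close> are doubled exponents of \<open>t\<close>; the extreme ones are \<open>2 r \<plusminus> degree C\<close>.\<close>
  have "2 * r + int ?n \<in> (*) 2 ` Poly_Mapping.keys \<Delta>"
    "2 * r - int ?n \<in> (*) 2 ` Poly_Mapping.keys \<Delta>"
    using C unfolding keys by (auto simp: extreme lookup_diff_monom1_power)
  then obtain u v where u: "u \<in> Poly_Mapping.keys \<Delta>" "2 * u = 2 * r + int ?n"
    and v: "v \<in> Poly_Mapping.keys \<Delta>" "2 * v = 2 * r - int ?n"
    by auto
  have bounds: "\<bar>2 * k - 2 * r\<bar> \<le> int ?n" if "k \<in> Poly_Mapping.keys \<Delta>" for k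
    using that keys[of "2 * k"] outside[of "2 * k - 2 * r"] by fastforce
  have "Max (Poly_Mapping.keys \<Delta>) = u"
    by (rule Max_eqI) (use u bounds in fastforce)+
  moreover have "Min (Poly_Mapping.keys \<Delta>) = v"
    by (rule Min_eqI) (use v bounds in fastforce)+
  ultimately show ?thesis
    using u v by (simp add: laurent_span_def)
qed

text \<open>The coefficients of \<open>p(1, z)\<close> add up all powers of \<open>a\<close>, which may cancel in general. At the
  exponent \<open>n\<close> there is only one power of \<open>a\<close>, so nothing cancels.\<close>

lemma degree_conway:
  assumes p: "z_leading_bound n p" "p \<noteq> 0" "int n \<le> deg_z p"
    and C: "subst_exponents snd p = poly (map_poly of_int C) (monom1 1)"
  shows "deg_z p = int n" and "C \<noteq> 0" and "degree C = n"
proof -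
  obtain e i0 where
    "\<forall>i j. int n \<le> j \<longrightarrow> Poly_Mapping.lookup p (i, j) = (e when (i, j) = (i0, int n))"
    using p(1) unfolding z_leading_bound_def by (elim bexE exE)
  note top = this[rule_format]
  have "deg_z p \<in> snd ` Poly_Mapping.keys p"
    unfolding deg_z_def using p(2) by (intro Max_in) simp_all
  then obtain m where "m \<in> Poly_Mapping.keys p" "deg_z p = snd m"
    by (rule imageE)
  then have "Poly_Mapping.lookup p (fst m, deg_z p) \<noteq> 0"
    by (simp add: in_keys_iff)
  then have "(e when (fst m, deg_z p) = (i0, int n)) \<noteq> 0"
    using top[OF p(3)] by simp
  then have e: "e \<noteq> 0" and "deg_z p = int n"
    by (auto simp: when_def split: if_splits)
  then show "deg_z p = int n" by blast
  have coeff_C: "coeff C k = (\<Sum>m\<in>{m \<in> Poly_Mapping.keys p. snd m = int k}. Poly_Mapping.lookup p m)"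
    for k
    using lookup_poly_monom1[of C k] unfolding C[symmetric] lookup_subst_exponents by (rule sym)
  have top_keys: "{m \<in> Poly_Mapping.keys p. snd m = int k} = (if k = n then {(i0, int n)} else {})"
    if "n \<le> k" for k
  proof -
    have "m \<in> Poly_Mapping.keys p \<and> snd m = int k \<longleftrightarrow> k = n \<and> m = (i0, int n)" for m
      using top[of "int k" "fst m"] e that
      by (cases m) (auto simp: in_keys_iff when_def split: if_splits)
    then show ?thesis by auto
  qed
  have "coeff C n = e"
    unfolding coeff_C top_keys[OF order_refl] using top[of "int n" i0] by simp
  then have "coeff C n \<noteq> 0" using e by simp
  moreover have "coeff C k = 0" if "n < k" for k
    unfolding coeff_C top_keys[OF less_imp_le[OF that]] using that by simp
  ultimately show "degree C = n" "C \<noteq> 0"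
    using degree_le[of n C] le_degree[of C n] by fastforce+
qed

theorem corollary3p3:
  fixes P :: "diagram \<Rightarrow> laurent2" and K :: diagram and \<Delta> :: laurent and d :: int
  assumes "is_homfly P"
    and "knot_diagram K"
    and "is_alexander P K \<Delta>"
    and "d = deg_z (P K)"
  shows "laurent_span \<Delta> < d \<longrightarrow> enat (nat (d + 1)) \<le> skein_tree_depth K"
proof
  assume span: "laurent_span \<Delta> < d"
  obtain C \<epsilon> r where C: "subst_exponents snd (P K) = poly (map_poly of_int C) (monom1 1)"
    and \<Delta>: "\<epsilon> \<in> {1, -1}"
      "subst_exponents ((*) 2) \<Delta> =
        \<epsilon> * monom1 (2 * r) * poly (map_poly of_int C) (monom1 1 - monom1 (-1))"
    using assms(3) unfolding is_alexander_def is_conway_def by blast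
  have "nat (d + 1) \<le> tree_depth T" if T: "valid_tree T" "K \<simeq> root T" for T
  proof (rule ccontr)
    \<comment> \<open>A negative \<open>d\<close> is excluded here, as \<open>nat (d + 1)\<close> would then be 0.\<close>
    assume "\<not> nat (d + 1) \<le> tree_depth T"
    then have depth: "int (tree_depth T) \<le> d" by linarith
    have PK: "P K = P (root T)"
      using homfly_invariant[OF assms(1) T(2)] .
    have "P K \<noteq> 0"
      using homfly_tree_eval[OF assms(1) T(1)] by (auto simp: PK eval_rat_def)
    moreover have "z_leading_bound (tree_depth T) (P K)"
      using z_leading_bound_tree[OF assms(1) T(1)] by (simp add: PK)
    ultimately have "d = int (degree C)" "C \<noteq> 0"
      using degree_conway[of "tree_depth T" "P K" C] depth C assms(4) by auto
    then show False
      using span laurent_span_alexander[OF _ \<Delta>] by simp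
  qed
  then show "enat (nat (d + 1)) \<le> skein_tree_depth K"
    unfolding skein_tree_depth_def by (intro INF_greatest) simp
qed

end
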